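(* For all $n\ge1$, $$a_{n,3,00}=\binom{n+1}{2}+2\binom{n}{3}+\binom{n-1}{4}+\binom{n+2}{5}.$$
   Context: For a finite integer sequence $(a_1,\dots,a_i)$, $\mathrm{asc}(a_1,\dots,a_i)=|\{j:1\le j<i,\ a_j<a_{j+1}\}|$. For an integer $p\ge1$, a $p$-ascent sequence of length $n\ge1$ is a sequence $(a_1,\dots,a_n)$ of nonnegative integers with $a_1=0$ and $a_i\le p+\mathrm{asc}(a_1,\dots,a_{i-1})$ for all $2\le i\le n$. $a_{n,p,00}$ is the number of $p$-ascent sequences of length $n$ avoiding the pattern $00$, i.e. having all letters distinct. Binomial coefficients $\binom{m}{k}$ with $0\le m<k$ are $0$. *)

theory Defs
  imports Main
begin

definition asc :: "nat list \<Rightarrow> nat" where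
  "asc xs = card {j. Suc j < length xs \<and> xs ! j < xs ! Suc j}"

(* The list is indexed from 0: xs ! i is the (i+1)-st letter, and take i xs is the
   sequence of all letters before it. *)
definition p_ascent_seq :: "nat \<Rightarrow> nat list \<Rightarrow> bool" where
  "p_ascent_seq p xs \<longleftrightarrow>
     xs \<noteq> [] \<and> xs ! 0 = 0 \<and>
     (\<forall>i. 1 \<le> i \<and> i < length xs \<longrightarrow> xs ! i \<le> p + asc (take i xs))"

(* Avoiding the pattern 00 means that no letter occurs twice. *)
definition avoids_00 :: "nat list \<Rightarrow> bool" where
  "avoids_00 xs \<longleftrightarrow> distinct xs"

definition num_p_ascent_00 :: "nat \<Rightarrow> nat \<Rightarrow> nat" where
  "num_p_ascent_00 n p = card {xs. length xs = n \<and> p_ascent_seq p xs \<and> avoids_00 xs}"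

end

theory Submission
  imports Defs
begin

text \<open>
  Call \<open>h\<close> a hole of a sequence if it is an admissible next letter that has not been used yet.
  Appending a hole below the last letter is a descent and uses up that hole; appending a hole
  above the last letter is an ascent, so the bound rises and one new hole appears at the top.
  Hence the number of continuations depends only on the number \<open>s\<close> of holes and on the number
  \<open>j\<close> of holes below the last letter. Since \<open>s\<close> starts at \<open>p\<close> and never increases, \<open>p = 3\<close> leaves a
  small linear recurrence, which is solved by repeated summation of binomial coefficients.
\<close>

lemma asc_snoc:
  assumes "xs \<noteq> []"
  shows "asc (xs @ [x]) = asc xs + (if last xs < x then 1 else 0)"
proof -
  let ?A = "{j. Suc j < length xs \<and> xs ! j < xs ! Suc j}"
  let ?B = "if last xs < x then {length xs - 1} else {}"
  have "{j. Suc j < length (xs @ [x]) \<and> (xs @ [x]) ! j < (xs @ [x]) ! Suc j} = ?A \<union> ?B"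
  proof (rule set_eqI)
    fix j
    consider "Suc j < length xs" | "Suc j = length xs" | "Suc j > length xs"
      by linarith
    then show "j \<in> {j. Suc j < length (xs @ [x]) \<and> (xs @ [x]) ! j < (xs @ [x]) ! Suc j}
        \<longleftrightarrow> j \<in> ?A \<union> ?B"
    proof cases
      case 2
      then have "j = length xs - 1" "xs ! j = last xs"
        using assms by (auto simp: last_conv_nth simp flip: 2)
      with 2 show ?thesis by (auto simp: nth_append)
    qed (use assms in \<open>auto simp: nth_append\<close>)
  qed
  moreover have "finite ?A"
    by (rule finite_subset[of _ "{..<length xs}"]) auto
  moreover have "?A \<inter> ?B = {}"
    using assms by auto
  ultimately show ?thesis
    by (simp add: asc_def card_Un_disjoint)
qed

lemma p_ascent_seq_snoc:
  assumes "xs \<noteq> []"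
  shows "p_ascent_seq p (xs @ [x]) \<longleftrightarrow> p_ascent_seq p xs \<and> x \<le> p + asc xs"
  using assms unfolding p_ascent_seq_def
  by (auto simp: nth_append less_Suc_eq Suc_le_eq)

lemma p_ascent_seq_singleton: "p_ascent_seq p [x] \<longleftrightarrow> x = 0"
  by (auto simp: p_ascent_seq_def)

lemma p_ascent_seq_prefix:
  assumes "p_ascent_seq p (xs @ ys)" "xs \<noteq> []"
  shows "p_ascent_seq p xs"
  using assms
proof (induction ys rule: rev_induct)
  case (snoc y ys)
  then show ?case using p_ascent_seq_snoc[of "xs @ ys"] by simp
qed simp

lemma p_ascent_seq_le:
  assumes "p_ascent_seq p xs"
  shows "set xs \<subseteq> {..p + asc xs}"
  using assms
proof (induction xs rule: rev_induct)
  case (snoc x xs)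
  show ?case
  proof (cases "xs = []")
    case True
    with snoc.prems show ?thesis by (simp add: p_ascent_seq_singleton)
  next
    case False
    with snoc show ?thesis by (fastforce simp: p_ascent_seq_snoc asc_snoc)
  qed
qed simp

definition holes :: "nat \<Rightarrow> nat list \<Rightarrow> nat set" where
  "holes p xs = {..p + asc xs} - set xs"

lemma finite_holes [simp]: "finite (holes p xs)"
  by (simp add: holes_def)

lemma holes_snoc_descent:
  assumes "xs \<noteq> []" "x < last xs"
  shows "holes p (xs @ [x]) = holes p xs - {x}"
  using assms by (auto simp: holes_def asc_snoc)

lemma holes_snoc_ascent:
  assumes "p_ascent_seq p xs" "xs \<noteq> []" "last xs < x" "x \<in> holes p xs"
  shows "holes p (xs @ [x]) = insert (Suc (p + asc xs)) (holes p xs - {x})"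
  using assms p_ascent_seq_le[OF assms(1)] by (auto simp: holes_def asc_snoc le_Suc_eq)

text \<open>Only the appended suffixes are collected, so that they split disjointly by their first
  letter.\<close>

definition extensions :: "nat \<Rightarrow> nat \<Rightarrow> nat list \<Rightarrow> nat list set" where
  "extensions p m xs = {ys. length ys = m \<and> p_ascent_seq p (xs @ ys) \<and> distinct (xs @ ys)}"

lemma extensions_0:
  "p_ascent_seq p xs \<Longrightarrow> distinct xs \<Longrightarrow> extensions p 0 xs = {[]}"
  by (auto simp: extensions_def)

lemma extensions_Suc:
  assumes "xs \<noteq> []"
  shows "extensions p (Suc m) xs = (\<Union>x\<in>holes p xs. Cons x ` extensions p m (xs @ [x]))"
proof -
  have "x \<in> holes p xs"
    if "p_ascent_seq p (xs @ x # ys)" "distinct (xs @ x # ys)" for x ys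
    using p_ascent_seq_prefix[of p "xs @ [x]" ys] that assms
    by (simp add: holes_def p_ascent_seq_snoc)
  then have "zs \<in> extensions p (Suc m) xs
      \<longleftrightarrow> (\<exists>x\<in>holes p xs. \<exists>ys\<in>extensions p m (xs @ [x]). zs = x # ys)" for zs
    by (cases zs) (auto simp: extensions_def)
  then show ?thesis by blast
qed

lemma finite_extensions: "xs \<noteq> [] \<Longrightarrow> finite (extensions p m xs)"
proof (induction m arbitrary: xs)
  case 0
  have "extensions p 0 xs \<subseteq> {[]}" by (auto simp: extensions_def)
  then show ?case by (rule finite_subset) simp
qed (simp add: extensions_Suc)

lemma card_extensions_Suc:
  assumes "xs \<noteq> []"
  shows "card (extensions p (Suc m) xs) = (\<Sum>x\<in>holes p xs. card (extensions p m (xs @ [x])))"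
proof -
  have "card (extensions p (Suc m) xs)
      = (\<Sum>x\<in>holes p xs. card (Cons x ` extensions p m (xs @ [x])))"
    unfolding extensions_Suc[OF assms]
    by (rule card_UN_disjoint) (auto simp: finite_extensions)
  then show ?thesis by (simp add: card_image)
qed

text \<open>Here \<open>m\<close> letters remain to be appended, and \<open>j\<close> of the
  \<open>s\<close> holes lie below the last letter. The first sum runs over descents, the second
  over ascents; the third argument of each summand is the number of old holes below the chosen
  one.\<close>

fun ext_count :: "nat \<Rightarrow> nat \<Rightarrow> nat \<Rightarrow> nat" where
  "ext_count 0 s j = 1"
| "ext_count (Suc m) s j =
     (\<Sum>i<j. ext_count m (s - 1) i) + (\<Sum>i<s - j. ext_count m s (j + i))"

text \<open>Ranks in \<open>A\<close> run through \<open>0, ..., card A - 1\<close> once each: a new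
  maximum has rank \<open>card A\<close> and leaves the other ranks unchanged.\<close>

lemma sum_rank:
  fixes A :: "'a::linorder set" and g :: "nat \<Rightarrow> 'b::comm_monoid_add"
  assumes "finite A"
  shows "(\<Sum>x\<in>A. g (card {y\<in>A. y < x})) = (\<Sum>i<card A. g i)"
  using assms
proof (induction A rule: finite_linorder_max_induct)
  case (insert b A)
  have "{y \<in> insert b A. y < x} = {y \<in> A. y < x}" if "x \<in> A" for x
    using insert.hyps that by (auto dest: less_asym)
  moreover have "{y \<in> insert b A. y < b} = A" "b \<notin> A"
    using insert.hyps by auto
  ultimately show ?case
    using insert by (simp add: add.commute)
qed simp

lemma card_extensions:
  assumes "p_ascent_seq p xs" "distinct xs"
  shows "card (extensions p m xs)
    = ext_count m (card (holes p xs)) (card {h\<in>holes p xs. h < last xs})"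
  using assms
proof (induction m arbitrary: xs)
  case 0
  then show ?case by (simp add: extensions_0)
next
  case (Suc m)
  let ?H = "holes p xs"
  let ?s = "card ?H"
  let ?L = "{h\<in>?H. h < last xs}"
  let ?U = "{h\<in>?H. last xs < h}"
  have ne: "xs \<noteq> []" using Suc.prems by (auto simp: p_ascent_seq_def)
  have last: "last xs \<notin> ?H" using ne by (simp add: holes_def)
  have split: "h < last xs \<or> last xs < h" if "h \<in> ?H" for h
    using that last by (metis linorder_neqE)
  then have H: "?H = ?L \<union> ?U" by blast
  have "card (?L \<union> ?U) = card ?L + card ?U"
    by (rule card_Un_disjoint) auto
  then have cardH: "?s = card ?L + card ?U"
    by (simp only: H[symmetric])
  have valid: "p_ascent_seq p (xs @ [x])" "distinct (xs @ [x])" if "x \<in> ?H" for x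
    using that Suc.prems ne by (auto simp: holes_def p_ascent_seq_snoc)
  have below: "card (extensions p m (xs @ [x])) = ext_count m (?s - 1) (card {h\<in>?L. h < x})"
    if "x \<in> ?L" for x
  proof -
    have "holes p (xs @ [x]) = ?H - {x}"
      using that ne by (simp add: holes_snoc_descent)
    \<comment> \<open>Everything below \<open>x\<close> is also below the old last letter, so the
      rank of \<open>x\<close> within \<open>?L\<close> suffices.\<close>
    moreover have "{h \<in> ?H - {x}. h < x} = {h\<in>?L. h < x}"
      using that by auto
    ultimately show ?thesis
      using that Suc.IH[OF valid, of x] by simp
  qed
  have above: "card (extensions p m (xs @ [x])) = ext_count m ?s (card ?L + card {h\<in>?U. h < x})"
    if "x \<in> ?U" for x
  proof -
    let ?H' = "insert (Suc (p + asc xs)) (?H - {x})"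
    have new: "Suc (p + asc xs) \<notin> ?H" by (simp add: holes_def)
    have x: "x \<in> ?H" "x \<le> p + asc xs" using that by (auto simp: holes_def)
    have "holes p (xs @ [x]) = ?H'"
      using that ne Suc.prems by (simp add: holes_snoc_ascent)
    \<comment> \<open>The new top hole replaces the consumed \<open>x\<close>. It lies above
      \<open>x\<close>, so it does not count among the holes below the new last letter.\<close>
    moreover have "card ?H' = ?s"
      using new x card_Suc_Diff1[OF finite_holes, of x p xs] by simp
    moreover have "{h \<in> ?H'. h < x} = ?L \<union> {h\<in>?U. h < x}"
      using x that split by auto
    moreover have "card (?L \<union> {h\<in>?U. h < x}) = card ?L + card {h\<in>?U. h < x}"
      by (rule card_Un_disjoint) auto
    ultimately show ?thesis
      using x Suc.IH[OF valid, of x] by simp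
  qed
  have "card (extensions p (Suc m) xs)
      = (\<Sum>x\<in>?L. card (extensions p m (xs @ [x]))) + (\<Sum>x\<in>?U. card (extensions p m (xs @ [x])))"
    unfolding card_extensions_Suc[OF ne]
    by (subst H, rule sum.union_disjoint) auto
  also have "\<dots> = (\<Sum>x\<in>?L. ext_count m (?s - 1) (card {h\<in>?L. h < x}))
      + (\<Sum>x\<in>?U. ext_count m ?s (card ?L + card {h\<in>?U. h < x}))"
    using below above by (simp only: cong: sum.cong)
  also have "\<dots> = (\<Sum>i<card ?L. ext_count m (?s - 1) i)
      + (\<Sum>i<card ?U. ext_count m ?s (card ?L + i))"
    using sum_rank[of ?L "ext_count m (?s - 1)"]
      sum_rank[of ?U "\<lambda>i. ext_count m ?s (card ?L + i)"] by simp
  also have "\<dots> = ext_count (Suc m) ?s (card ?L)"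
    using cardH by simp
  finally show ?case .
qed

lemma num_p_ascent_00_Suc: "num_p_ascent_00 (Suc m) p = ext_count m p 0"
proof -
  have "{xs. length xs = Suc m \<and> p_ascent_seq p xs \<and> avoids_00 xs} = Cons 0 ` extensions p m [0]"
    by (auto simp: extensions_def avoids_00_def length_Suc_conv p_ascent_seq_def)
  \<comment> \<open>After the forced first letter 0 there are \<open>p\<close> holes, none of them
    below 0.\<close>
  moreover have "holes p [0] = {1..p}"
    by (auto simp: holes_def asc_def)
  ultimately show ?thesis
    using card_extensions[of p "[0]" m]
    by (simp add: num_p_ascent_00_def card_image p_ascent_seq_singleton)
qed

text \<open>The closed forms start here. The pairs \<open>(s, j)\<close> are ordered so that each
  recurrence reads f(m+1) = f(m) + (terms already solved).\<close>

lemma ext_count_1_0: "ext_count m 1 0 = 1"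
  by (induction m) simp_all

lemma ext_count_2_1: "ext_count m 2 1 = m + 1"
proof (induction m)
  case (Suc m)
  then show ?case using ext_count_1_0[of m] by simp
qed simp

lemma ext_count_2_0: "ext_count m 2 0 = 1 + (Suc m choose 2)"
proof (induction m)
  case (Suc m)
  \<comment> \<open>Rewriting numerals as successors unrolls the short sums and lets Pascal's rule
    expand the binomials.\<close>
  then show ?case using ext_count_2_1[of m] by (simp add: numeral_eq_Suc)
qed simp

lemma ext_count_3_2: "ext_count m 3 2 = 1 + m + (m + 2 choose 3)"
proof (induction m)
  case (Suc m)
  then show ?case using ext_count_2_0[of m] ext_count_2_1[of m] by (simp add: numeral_eq_Suc)
qed simp

lemma ext_count_3_1:
  "ext_count m 3 1 = 1 + 2 * m + (m choose 2) + (m + 1 choose 3) + (m + 2 choose 4)"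
proof (induction m)
  case (Suc m)
  then show ?case using ext_count_2_0[of m] ext_count_3_2[of m] by (simp add: numeral_eq_Suc)
qed simp

text \<open>The increment in \<open>m\<close> is \<open>ext_count m 3 1 + ext_count m 3 2\<close>;
  Pascal's rule matches it with the increment of the right-hand side.\<close>

lemma ext_count_3_0:
  "ext_count m 3 0 = (m + 2 choose 2) + 2 * (m + 1 choose 3) + (m choose 4) + (m + 3 choose 5)"
proof (induction m)
  case (Suc m)
  then show ?case using ext_count_3_1[of m] ext_count_3_2[of m] by (simp add: numeral_eq_Suc)
qed (simp add: numeral_eq_Suc)

theorem theorem4p2:
  fixes n :: nat
  assumes "n \<ge> 1"
  shows "num_p_ascent_00 n 3 =
    ((n + 1) choose 2) + 2 * (n choose 3) + ((n - 1) choose 4) + ((n + 2) choose 5)"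
proof -
  obtain m where "n = Suc m" using assms by (cases n) auto
  then show ?thesis using ext_count_3_0[of m] by (simp add: num_p_ascent_00_Suc numeral_eq_Suc del: ext_count.simps)
qed

end
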